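(* Let $r\ge 3$ be an integer, let $a_1,\dots,a_r$ be positive integers, and let $\mathcal{G}=K_{a_1,\dots,a_r}$ be the complete multipartite graph with vertex classes of sizes $a_1,\dots,a_r$. Then $$M(\mathcal{G})=n+\binom{n}{2}+\sum_{\substack{U\subseteq\{1,\dots,r\}\\ \#U\equiv 1\ (\mathrm{mod}\ 2),\ \#U\ge 3}}\ \prod_{i\in U}a_i,$$ where $n=\sum_{i=1}^r a_i$.
   Context: Graphs are finite, simple and undirected. The complete multipartite graph $K_{a_1,\dots,a_r}$ has $n=\sum_i a_i$ vertices partitioned into $r$ classes of sizes $a_1,\dots,a_r$, two vertices being adjacent iff they lie in different classes. For a graph $\mathcal{G}$ with $n$ vertices and adjacency matrix $A$, viewed over $\mathbb{F}_2$, let $C(\mathcal{G})\subseteq\mathbb{F}_2^{2n}$ be the binary linear code generated by the rows of $[I_n|A]$, where $I_n$ is the $n\times n$ identity matrix. The support of a vector is the set of positions of its nonzero entries. A nonzero codeword $c$ of a binary linear code $C$ is minimal if there is no nonzero codeword $c'\in C$ with $\operatorname{supp}(c')\subsetneq\operatorname{supp}(c)$. $M(\mathcal{G})$ denotes the number of minimal codewords of $C(\mathcal{G})$; it does not depend on the labeling of the vertices. *)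

theory Defs
  imports "HOL-Library.Z2" "Jordan_Normal_Form.VS_Connect"
begin

type_synonym 'v ugraph = "'v set \<times> 'v set set"

definition simple_graph :: "'v ugraph \<Rightarrow> bool" where
  "simple_graph G \<longleftrightarrow> finite (fst G) \<and>
     (\<forall>e \<in> snd G. \<exists>x \<in> fst G. \<exists>y \<in> fst G. x \<noteq> y \<and> e = {x, y})"

text \<open>Class \<open>i \<in> {1..r}\<close> of \<open>K(a 1, \<dots>, a r)\<close> consists of the pairs \<open>(i, j)\<close> with \<open>j < a i\<close>.\<close>

definition complete_multipartite :: "nat \<Rightarrow> (nat \<Rightarrow> nat) \<Rightarrow> (nat \<times> nat) ugraph" where
  "complete_multipartite r a =
     (let V = (SIGMA i:{1..r}. {..<a i})
      in (V, {{x, y} | x y. x \<in> V \<and> y \<in> V \<and> fst x \<noteq> fst y}))"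

text \<open>A labeling lists every vertex exactly once; vertex \<open>vs ! i\<close> indexes row and column \<open>i\<close> of
  the adjacency matrix.\<close>

definition labeling :: "'v ugraph \<Rightarrow> 'v list \<Rightarrow> bool" where
  "labeling G vs \<longleftrightarrow> distinct vs \<and> set vs = fst G"

definition adjacency_matrix :: "'v ugraph \<Rightarrow> 'v list \<Rightarrow> bit mat" where
  "adjacency_matrix G vs =
     mat (length vs) (length vs) (\<lambda>(i, j). if {vs ! i, vs ! j} \<in> snd G then 1 else 0)"

definition augment :: "'a mat \<Rightarrow> 'a mat \<Rightarrow> 'a mat" where
  "augment A B = mat (dim_row A) (dim_col A + dim_col B)
     (\<lambda>(i, j). if j < dim_col A then A $$ (i, j) else B $$ (i, j - dim_col A))"

definition graph_code :: "'v ugraph \<Rightarrow> 'v list \<Rightarrow> bit vec set" where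
  "graph_code G vs = vec_space.row_space (2 * length vs)
     (augment (1\<^sub>m (length vs)) (adjacency_matrix G vs))"

definition supp_vec :: "'a::zero vec \<Rightarrow> nat set" where
  "supp_vec c = {i. i < dim_vec c \<and> c $ i \<noteq> 0}"

definition minimal_codeword :: "bit vec set \<Rightarrow> bit vec \<Rightarrow> bool" where
  "minimal_codeword C c \<longleftrightarrow> c \<in> C \<and> c \<noteq> 0\<^sub>v (dim_vec c) \<and>
     \<not> (\<exists>c' \<in> C. c' \<noteq> 0\<^sub>v (dim_vec c') \<and> supp_vec c' \<subset> supp_vec c)"

definition num_minimal_codewords :: "'v ugraph \<Rightarrow> 'v list \<Rightarrow> nat" where
  "num_minimal_codewords G vs = card {c. minimal_codeword (graph_code G vs) c}"

lemma simple_graph_complete_multipartite: "simple_graph (complete_multipartite r a)"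
  by (fastforce simp: simple_graph_def complete_multipartite_def Let_def)

lemma card_complete_multipartite: "card (fst (complete_multipartite r a)) = (\<Sum>i=1..r. a i)"
  by (simp add: complete_multipartite_def Let_def)

text \<open>The code lies in \<open>F\<^sub>2\<^sup>2\<^sup>n\<close>; in particular it is finite, so that the cardinality in
  \<^const>\<open>num_minimal_codewords\<close> is not the default value of an infinite set.\<close>

lemma augment_carrier:
  assumes "A \<in> carrier_mat m k" "B \<in> carrier_mat m l"
  shows "augment A B \<in> carrier_mat m (k + l)"
  using assms by (auto simp: augment_def)

lemma graph_code_subset: "graph_code G vs \<subseteq> carrier_vec (2 * length vs)"
proof -
  interpret vec_space "TYPE(bit)" "2 * length vs" .
  let ?G = "augment (1\<^sub>m (length vs)) (adjacency_matrix G vs)"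
  have "?G \<in> carrier_mat (length vs) (length vs + length vs)"
    by (rule augment_carrier) (auto simp: adjacency_matrix_def)
  then have G: "?G \<in> carrier_mat (length vs) (2 * length vs)" by (simp add: mult_2)
  show ?thesis using row_space_eq[OF G] G by (auto simp: graph_code_def)
qed

lemma finite_graph_code: "finite (graph_code G vs)"
proof (rule finite_subset[OF graph_code_subset])
  have "(UNIV :: bit set) = {0, 1}" by (auto intro: bit.exhaust)
  then have "finite (UNIV :: bit set)" by (metis finite.emptyI finite_insert)
  then have "finite {xs :: bit list. set xs \<subseteq> UNIV \<and> length xs = 2 * length vs}"
    by (rule finite_lists_length_eq)
  then have "finite (vec_of_list ` {xs :: bit list. set xs \<subseteq> UNIV \<and> length xs = 2 * length vs})"
    by (rule finite_imageI)
  moreover have "carrier_vec (2 * length vs) \<subseteq>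
      vec_of_list ` {xs :: bit list. set xs \<subseteq> UNIV \<and> length xs = 2 * length vs}"
    by (force intro: image_eqI[of _ _ "list_of_vec _"] simp: vec_list)
  ultimately show "finite (carrier_vec (2 * length vs) :: bit vec set)"
    by (rule finite_subset[rotated])
qed

end

theory Submission
  imports Defs
begin

text \<open>Every codeword is determined by its left half, so the codewords correspond to the vertex
  sets \<open>S\<close>: the left half of the codeword of \<open>S\<close> is the indicator of \<open>S\<close>, and the right half is
  the indicator of the set \<open>O(S)\<close> of vertices with an odd number of neighbours in \<open>S\<close>
  (\<open>graph_code_eq_image\<close>). Comparing supports means comparing both sets, so minimal codewords
  correspond to nonempty \<open>S\<close> such that no nonempty \<open>T \<subset> S\<close> satisfies \<open>O(T) \<subseteq> O(S)\<close>
  (\<open>num_minimal_codewords_eq_card\<close>).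

  In a complete multipartite graph \<open>O(S)\<close> is a union of classes: a vertex belongs to it iff the
  number of elements of \<open>S\<close> outside its class is odd. If \<open>S\<close> is a partial transversal, meaning
  that it has at most one vertex in each class, then \<open>O(S)\<close> consists of the classes met by \<open>S\<close>
  when \<open>card S\<close> is even, and of the classes missed by \<open>S\<close> when \<open>card S\<close> is odd. The minimal sets
  are then exactly the following.

  \<^item> All singletons, for trivial reasons.
  \<^item> All pairs: \<open>O\<close> of a pair is empty or the union of the two classes met, while \<open>O\<close> of a single
    vertex contains every other class, in particular a third one.
  \<^item> The partial transversals of odd size at least 3: if \<open>T\<close> is a proper nonempty subset of \<open>S\<close>, then
    \<open>O(T)\<close> contains a class that \<open>S\<close> meets, namely one met by \<open>T\<close> if \<open>card T\<close> is even, and one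
    met by \<open>S - T\<close> if \<open>card T\<close> is odd.

  No other set of at least 3 vertices is minimal: two vertices of the same class form a pair
  \<open>T\<close> with \<open>O(T) = {}\<close>, and in a partial transversal of even size any pair \<open>T\<close> satisfies
  \<open>O(T) \<subseteq> O(S)\<close>. Counting the transversals by the set \<open>U\<close> of classes they meet gives the sum of
  products (\<open>card_transversals\<close>).\<close>

section \<open>Codewords of a graph code as vertex sets\<close>

text \<open>The vertices with an odd number of neighbours in \<open>S\<close>.\<close>

definition odd_neighbours :: "'v ugraph \<Rightarrow> 'v set \<Rightarrow> 'v set" where
  "odd_neighbours G S = {v \<in> fst G. odd (card {u \<in> S. {u, v} \<in> snd G})}"

text \<open>The sum over the binary field of the generator rows indexed by \<open>S\<close>, given by its
  coordinates.\<close>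

definition graph_codeword :: "'v ugraph \<Rightarrow> 'v list \<Rightarrow> 'v set \<Rightarrow> bit vec" where
  "graph_codeword G vs S = vec (2 * length vs)
     (\<lambda>j. if j < length vs then of_bool (vs ! j \<in> S)
          else of_bool (vs ! (j - length vs) \<in> odd_neighbours G S))"

text \<open>The vertex sets whose codewords are minimal, see
  \<open>minimal_codeword_graph_codeword_iff\<close> below. Strict inclusion is required of the vertex
  sets only, since two codewords that agree on the left half are equal.\<close>

definition minimal_vertex_set :: "'v ugraph \<Rightarrow> 'v set \<Rightarrow> bool" where
  "minimal_vertex_set G S \<longleftrightarrow> S \<subseteq> fst G \<and> S \<noteq> {} \<and>
     \<not> (\<exists>T. T \<noteq> {} \<and> T \<subset> S \<and> odd_neighbours G T \<subseteq> odd_neighbours G S)"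

lemma of_nat_bit_eq_of_bool: "(of_nat k :: bit) = of_bool (odd k)"
  by (induction k) auto

lemma adjacency_matrix_carrier:
  "adjacency_matrix G vs \<in> carrier_mat (length vs) (length vs)"
  by (simp add: adjacency_matrix_def)

text \<open>The linear combination of the generator rows with the indicator of \<open>S\<close> as coefficients.
  In the right half, coordinate \<open>v\<close> is the number of neighbours of \<open>v\<close> in \<open>S\<close> modulo 2.\<close>

lemma transpose_generator_mult_vec:
  assumes lab: "labeling G vs" and S: "S \<subseteq> fst G"
  shows "transpose_mat (augment (1\<^sub>m (length vs)) (adjacency_matrix G vs)) *\<^sub>v
           vec (length vs) (\<lambda>i. of_bool (vs ! i \<in> S)) = graph_codeword G vs S"
    (is "?M *\<^sub>v ?y = _")
proof (rule eq_vecI)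
  let ?n = "length vs"
  have dist: "distinct vs" and setvs: "set vs = fst G"
    using lab by (auto simp: labeling_def)
  show "dim_vec (?M *\<^sub>v ?y) = dim_vec (graph_codeword G vs S)"
    by (simp add: augment_def adjacency_matrix_def graph_codeword_def)
  fix j assume "j < dim_vec (graph_codeword G vs S)"
  then have j: "j < 2 * ?n" by (simp add: graph_codeword_def)
  have entry: "(?M *\<^sub>v ?y) $ j =
      (\<Sum>i<?n. (if j < ?n then of_bool (i = j)
               else of_bool ({vs ! i, vs ! (j - ?n)} \<in> snd G)) * of_bool (vs ! i \<in> S))"
  proof -
    have "(?M *\<^sub>v ?y) $ j = (\<Sum>i<?n. ?M $$ (j, i) * ?y $ i)"
      using j by (simp add: scalar_prod_def augment_def adjacency_matrix_def lessThan_atLeast0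
          del: sum_of_bool_eq mult_bit_eq_and add_bit_eq_xor)
    also have "\<dots> = (\<Sum>i<?n. (if j < ?n then of_bool (i = j)
               else of_bool ({vs ! i, vs ! (j - ?n)} \<in> snd G)) * of_bool (vs ! i \<in> S))"
      using j by (intro sum.cong refl) (auto simp: augment_def adjacency_matrix_def)
    finally show ?thesis .
  qed
  show "(?M *\<^sub>v ?y) $ j = graph_codeword G vs S $ j"
  proof (cases "j < ?n")
    case True
    have "(?M *\<^sub>v ?y) $ j = (\<Sum>i<?n. if i = j then of_bool (vs ! i \<in> S) else 0)"
      unfolding entry using True by (intro sum.cong) auto
    then show ?thesis using True by (simp add: graph_codeword_def)
  next
    case False
    define v where "v = vs ! (j - ?n)"
    have v: "v \<in> fst G" using False j unfolding v_def setvs[symmetric] by simp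
    have "(?M *\<^sub>v ?y) $ j = (\<Sum>i<?n. of_bool (vs ! i \<in> S \<and> {vs ! i, v} \<in> snd G))"
      unfolding entry using False by (intro sum.cong) (auto simp: v_def)
    also have "\<dots> = of_nat (card {i \<in> {..<?n}. vs ! i \<in> S \<and> {vs ! i, v} \<in> snd G})"
      by (simp add: Int_def)
    also have "card {i \<in> {..<?n}. vs ! i \<in> S \<and> {vs ! i, v} \<in> snd G}
        = card {u \<in> S. {u, v} \<in> snd G}"
    proof (rule bij_betw_same_card[of "\<lambda>i. vs ! i"])
      show "bij_betw (\<lambda>i. vs ! i)
          {i \<in> {..<?n}. vs ! i \<in> S \<and> {vs ! i, v} \<in> snd G} {u \<in> S. {u, v} \<in> snd G}"
        using dist S setvs
        by (auto simp: bij_betw_def inj_on_def nth_eq_iff_index_eq image_iff)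
           (metis in_set_conv_nth subsetD)
    qed
    finally show ?thesis
      using False j v by (simp add: graph_codeword_def odd_neighbours_def of_nat_bit_eq_of_bool v_def)
  qed
qed

lemma graph_code_eq_image:
  assumes lab: "labeling G vs"
  shows "graph_code G vs = graph_codeword G vs ` Pow (fst G)"
proof -
  let ?n = "length vs" and ?M = "augment (1\<^sub>m (length vs)) (adjacency_matrix G vs)"
  interpret vec_space "TYPE(bit)" "2 * ?n" .
  have dist: "distinct vs" and setvs: "set vs = fst G"
    using lab by (auto simp: labeling_def)
  have M: "?M \<in> carrier_mat ?n (2 * ?n)"
    using augment_carrier[OF one_carrier_mat adjacency_matrix_carrier, of vs G]
    by (simp add: mult_2)
  have code: "graph_code G vs = {transpose_mat ?M *\<^sub>v y | y. y \<in> carrier_vec ?n}"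
    using row_space_eq[OF M] M by (auto simp: graph_code_def)
  have ex: "\<exists>S \<subseteq> fst G. y = vec ?n (\<lambda>i. of_bool (vs ! i \<in> S))"
    if y: "y \<in> carrier_vec ?n" for y :: "bit vec"
  proof -
    let ?S = "(!) vs ` {i. i < ?n \<and> y $ i = 1}"
    have "?S \<subseteq> fst G" unfolding setvs[symmetric] by auto
    moreover have "y = vec ?n (\<lambda>i. of_bool (vs ! i \<in> ?S))"
    proof (rule eq_vecI)
      fix i assume "i < dim_vec (vec ?n (\<lambda>i. of_bool (vs ! i \<in> ?S)) :: bit vec)"
      then have i: "i < ?n" by simp
      then have "vs ! i \<in> ?S \<longleftrightarrow> y $ i = 1"
        using dist by (auto simp: nth_eq_iff_index_eq)
      with i show "y $ i = vec ?n (\<lambda>i. of_bool (vs ! i \<in> ?S)) $ i"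
        by (cases "y $ i") simp_all
    qed (use y in simp)
    ultimately show ?thesis by blast
  qed
  show ?thesis
  proof (intro equalityI subsetI)
    fix c assume "c \<in> graph_code G vs"
    then obtain y where y: "y \<in> carrier_vec ?n" "c = transpose_mat ?M *\<^sub>v y"
      unfolding code by blast
    with ex obtain S where "S \<subseteq> fst G" "y = vec ?n (\<lambda>i. of_bool (vs ! i \<in> S))" by blast
    with y(2) transpose_generator_mult_vec[OF lab] show "c \<in> graph_codeword G vs ` Pow (fst G)" by blast
  next
    fix c assume "c \<in> graph_codeword G vs ` Pow (fst G)"
    then obtain S where S: "S \<subseteq> fst G" "c = graph_codeword G vs S" by blast
    have "vec ?n (\<lambda>i. of_bool (vs ! i \<in> S)) \<in> carrier_vec ?n" by simp
    with S transpose_generator_mult_vec[OF lab S(1)] show "c \<in> graph_code G vs"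
      unfolding code by (metis (mono_tags, lifting) mem_Collect_eq)
  qed
qed

lemma supp_graph_codeword:
  "supp_vec (graph_codeword G vs S) =
     {i. i < length vs \<and> vs ! i \<in> S} \<union>
     {length vs + i | i. i < length vs \<and> vs ! i \<in> odd_neighbours G S}"
proof (rule Set.set_eqI)
  fix j
  show "j \<in> supp_vec (graph_codeword G vs S) \<longleftrightarrow> j \<in> {i. i < length vs \<and> vs ! i \<in> S} \<union>
     {length vs + i | i. i < length vs \<and> vs ! i \<in> odd_neighbours G S}"
  proof (cases "j < length vs")
    case True
    then show ?thesis by (auto simp: supp_vec_def graph_codeword_def)
  next
    case False
    then obtain k where "j = length vs + k" by (metis le_add_diff_inverse not_less)
    then show ?thesis by (auto simp: supp_vec_def graph_codeword_def)
  qed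
qed

lemma supp_graph_codeword_subset_iff:
  assumes lab: "labeling G vs" and S: "S \<subseteq> fst G" and T: "T \<subseteq> fst G"
  shows "supp_vec (graph_codeword G vs T) \<subseteq> supp_vec (graph_codeword G vs S) \<longleftrightarrow>
     T \<subseteq> S \<and> odd_neighbours G T \<subseteq> odd_neighbours G S"
proof -
  have index: "A \<subseteq> B \<longleftrightarrow> (\<forall>i < length vs. vs ! i \<in> A \<longrightarrow> vs ! i \<in> B)" if "A \<subseteq> fst G" for A B
    using that lab unfolding labeling_def by (metis in_set_conv_nth nth_mem subset_iff)
  have "odd_neighbours G T \<subseteq> fst G" by (auto simp: odd_neighbours_def)
  from index[OF T, of S] index[OF this, of "odd_neighbours G S"] show ?thesis
    by (auto simp: supp_graph_codeword subset_iff)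
qed

lemma graph_codeword_inj:
  assumes lab: "labeling G vs"
  shows "inj_on (graph_codeword G vs) (Pow (fst G))"
  using supp_graph_codeword_subset_iff[OF lab] by (intro inj_onI) (metis PowD subset_antisym order_refl)

lemma graph_codeword_zero_iff:
  assumes lab: "labeling G vs" and S: "S \<subseteq> fst G"
  shows "graph_codeword G vs S = 0\<^sub>v (dim_vec (graph_codeword G vs S)) \<longleftrightarrow> S = {}"
proof -
  have "graph_codeword G vs {} = 0\<^sub>v (dim_vec (graph_codeword G vs S))"
    by (auto simp: graph_codeword_def odd_neighbours_def)
  then show ?thesis
    using graph_codeword_inj[OF lab] S by (metis PowI empty_subsetI inj_on_def)
qed

lemma minimal_codeword_graph_codeword_iff:
  assumes lab: "labeling G vs" and S: "S \<subseteq> fst G"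
  shows "minimal_codeword (graph_code G vs) (graph_codeword G vs S) \<longleftrightarrow> minimal_vertex_set G S"
proof -
  have sub: "supp_vec (graph_codeword G vs T) \<subset> supp_vec (graph_codeword G vs S) \<longleftrightarrow>
      T \<subset> S \<and> odd_neighbours G T \<subseteq> odd_neighbours G S" if "T \<subseteq> fst G" for T
    using supp_graph_codeword_subset_iff[OF lab S that]
      supp_graph_codeword_subset_iff[OF lab that S] by blast
  have "(\<exists>c' \<in> graph_code G vs. c' \<noteq> 0\<^sub>v (dim_vec c') \<and>
          supp_vec c' \<subset> supp_vec (graph_codeword G vs S)) \<longleftrightarrow>
      (\<exists>T. T \<noteq> {} \<and> T \<subset> S \<and> odd_neighbours G T \<subseteq> odd_neighbours G S)"
      (is "?L \<longleftrightarrow> ?R")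
  proof
    assume ?L
    then obtain T where T: "T \<subseteq> fst G"
        "graph_codeword G vs T \<noteq> 0\<^sub>v (dim_vec (graph_codeword G vs T))"
        "supp_vec (graph_codeword G vs T) \<subset> supp_vec (graph_codeword G vs S)"
      unfolding graph_code_eq_image[OF lab] by blast
    then show ?R
      using sub[OF T(1)] graph_codeword_zero_iff[OF lab T(1)] by blast
  next
    assume ?R
    then obtain T where T: "T \<noteq> {}" "T \<subset> S" "odd_neighbours G T \<subseteq> odd_neighbours G S"
      by blast
    then have TV: "T \<subseteq> fst G" using S by blast
    with T show ?L
      unfolding graph_code_eq_image[OF lab]
      using sub[OF TV] graph_codeword_zero_iff[OF lab TV] by blast
  qed
  moreover have "graph_codeword G vs S \<in> graph_code G vs"
    unfolding graph_code_eq_image[OF lab] using S by blast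
  ultimately show ?thesis
    unfolding minimal_codeword_def minimal_vertex_set_def
    using S graph_codeword_zero_iff[OF lab S] by blast
qed

lemma num_minimal_codewords_eq_card:
  assumes lab: "labeling G vs"
  shows "num_minimal_codewords G vs = card {S. minimal_vertex_set G S}"
proof -
  have "{c. minimal_codeword (graph_code G vs) c} = graph_codeword G vs ` {S. minimal_vertex_set G S}"
  proof (intro equalityI subsetI)
    fix c assume "c \<in> {c. minimal_codeword (graph_code G vs) c}"
    then have c: "minimal_codeword (graph_code G vs) c" by simp
    then have "c \<in> graph_code G vs" by (simp add: minimal_codeword_def)
    then obtain S where "S \<subseteq> fst G" "c = graph_codeword G vs S"
      unfolding graph_code_eq_image[OF lab] by blast
    with c minimal_codeword_graph_codeword_iff[OF lab]
    show "c \<in> graph_codeword G vs ` {S. minimal_vertex_set G S}" by blast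
  next
    fix c assume "c \<in> graph_codeword G vs ` {S. minimal_vertex_set G S}"
    then obtain S where S: "minimal_vertex_set G S" "c = graph_codeword G vs S" by blast
    then have "S \<subseteq> fst G" by (simp add: minimal_vertex_set_def)
    with S minimal_codeword_graph_codeword_iff[OF lab]
    show "c \<in> {c. minimal_codeword (graph_code G vs) c}" by blast
  qed
  moreover have "inj_on (graph_codeword G vs) {S. minimal_vertex_set G S}"
    by (rule inj_on_subset[OF graph_codeword_inj[OF lab]]) (auto simp: minimal_vertex_set_def)
  ultimately show ?thesis by (simp add: num_minimal_codewords_def card_image)
qed

section \<open>Minimal vertex sets of a complete multipartite graph\<close>

lemma fst_complete_multipartite:
  "fst (complete_multipartite r a) = (SIGMA i:{1..r}. {..<a i})"
  by (simp add: complete_multipartite_def Let_def)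

lemma finite_subset_vertices:
  assumes "S \<subseteq> fst (complete_multipartite r a)"
  shows "finite S"
  using assms by (rule finite_subset) (simp add: fst_complete_multipartite)

lemma odd_neighbours_complete_multipartite:
  assumes S: "S \<subseteq> fst (complete_multipartite r a)"
  shows "odd_neighbours (complete_multipartite r a) S =
     {v \<in> fst (complete_multipartite r a). odd (card {u \<in> S. fst u \<noteq> fst v})}"
proof -
  let ?G = "complete_multipartite r a"
  have adj: "{u, v} \<in> snd ?G \<longleftrightarrow> fst u \<noteq> fst v" if "u \<in> fst ?G" "v \<in> fst ?G" for u v
    using that unfolding complete_multipartite_def Let_def snd_conv fst_conv mem_Collect_eq
    by (metis doubleton_eq_iff)
  have "{u \<in> S. {u, v} \<in> snd ?G} = {u \<in> S. fst u \<noteq> fst v}" if "v \<in> fst ?G" for v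
    using that S adj by blast
  then show ?thesis by (auto simp: odd_neighbours_def)
qed

text \<open>No truncation occurs in the subtraction: if \<open>i \<in> fst ` S\<close> then \<open>S\<close> is nonempty.\<close>

lemma card_other_classes_transversal:
  assumes "finite S" "inj_on fst S"
  shows "card {u \<in> S. fst u \<noteq> i} = card S - of_bool (i \<in> fst ` S)"
proof (cases "i \<in> fst ` S")
  case True
  then obtain w where w: "w \<in> S" "fst w = i" by blast
  then have "{u \<in> S. fst u \<noteq> i} = S - {w}" using assms(2) by (auto simp: inj_on_def)
  with w True assms(1) show ?thesis by simp
next
  case False
  then have "{u \<in> S. fst u \<noteq> i} = S" by auto
  with False show ?thesis by simp
qed

text \<open>A set with at most one vertex in each class is described by injectivity of \<^const>\<open>fst\<close>,
  the map sending a vertex to its class.\<close>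

lemma odd_neighbours_transversal:
  assumes S: "S \<subseteq> fst (complete_multipartite r a)" and inj: "inj_on fst S"
  shows "odd_neighbours (complete_multipartite r a) S =
     {v \<in> fst (complete_multipartite r a). fst v \<in> fst ` S \<longleftrightarrow> even (card S)}"
proof -
  have fin: "finite S" by (rule finite_subset_vertices[OF S])
  have "odd (card S - of_bool (i \<in> fst ` S)) \<longleftrightarrow> (i \<in> fst ` S \<longleftrightarrow> even (card S))" for i
    using fin by (cases "card S") auto
  then show ?thesis
    unfolding odd_neighbours_complete_multipartite[OF S] card_other_classes_transversal[OF fin inj]
    by blast
qed

lemma odd_neighbours_same_class:
  assumes "{u, v} \<subseteq> fst (complete_multipartite r a)" "u \<noteq> v" "fst u = fst v"
  shows "odd_neighbours (complete_multipartite r a) {u, v} = {}"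
proof -
  have "even (card {x \<in> {u, v}. fst x \<noteq> i})" for i
  proof (cases "i = fst u")
    case True
    then have "{x \<in> {u, v}. fst x \<noteq> i} = {}" using assms(3) by auto
    then show ?thesis by (simp only: card.empty dvd_0_right)
  next
    case False
    then have "{x \<in> {u, v}. fst x \<noteq> i} = {u, v}" using assms(3) by auto
    moreover have "card {u, v} = 2" using assms(2) by simp
    ultimately show ?thesis by (metis dvd_refl)
  qed
  then show ?thesis unfolding odd_neighbours_complete_multipartite[OF assms(1)] by blast
qed

lemma minimal_vertex_set_singleton:
  assumes "v \<in> fst G"
  shows "minimal_vertex_set G {v}"
  using assms by (auto simp: minimal_vertex_set_def)

lemma minimal_vertex_set_pair:
  assumes r: "r \<ge> 3" and pos: "\<And>i. i \<in> {1..r} \<Longrightarrow> a i > 0"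
    and S: "S \<subseteq> fst (complete_multipartite r a)" and card: "card S = 2"
  shows "minimal_vertex_set (complete_multipartite r a) S"
proof -
  let ?G = "complete_multipartite r a"
  have notsub: "\<not> odd_neighbours ?G T \<subseteq> odd_neighbours ?G S" if T: "T \<noteq> {}" "T \<subset> S" for T
  proof -
    have "finite S" using card by (simp add: card_ge_0_finite)
    with T card have "card T < 2" "card T \<noteq> 0"
      using psubset_card_mono[of S T] finite_subset[of T S] by auto
    then have "card T = 1" by simp
    then obtain u where u: "T = {u}" by (metis card_1_singletonE)
    from card obtain x y where xy: "S = {x, y}" "x \<noteq> y" by (auto simp: card_2_iff)
    \<comment> \<open>A class that avoids \<open>S\<close> belongs to the odd neighbours of \<open>T\<close> but not to those of \<open>S\<close>.\<close>
    obtain k where k: "k \<in> {1..r}" "k \<noteq> fst x" "k \<noteq> fst y"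
    proof -
      have "card ({1..r} - {fst x, fst y}) \<ge> card {1..r} - card {fst x, fst y}"
        by (rule diff_card_le_card_Diff) simp
      moreover have "card {fst x, fst y} \<le> 2" by (simp add: card_insert_if)
      ultimately have "card ({1..r} - {fst x, fst y}) \<noteq> 0"
        using r by (simp del: card_0_eq)
      then have "{1..r} - {fst x, fst y} \<noteq> {}" by (metis card.empty)
      with that show thesis by blast
    qed
    have kV: "(k, 0) \<in> fst ?G" using k(1) pos by (simp add: fst_complete_multipartite)
    have uS: "u \<in> {x, y}" using u T xy by blast
    have TV: "T \<subseteq> fst ?G" using T(2) S by blast
    have "k \<notin> fst ` T" using uS k(2,3) unfolding u by auto
    moreover have "inj_on fst T" unfolding u by simp
    ultimately have "(k, 0) \<in> odd_neighbours ?G T"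
      using kV \<open>card T = 1\<close> by (simp add: odd_neighbours_transversal[OF TV])
    moreover have "{w \<in> S. fst w \<noteq> k} = S" using xy k by auto
    then have "(k, 0) \<notin> odd_neighbours ?G S"
      unfolding odd_neighbours_complete_multipartite[OF S] using card by simp
    ultimately show ?thesis by blast
  qed
  moreover have "S \<noteq> {}" using card by auto
  ultimately show ?thesis using S by (auto simp: minimal_vertex_set_def)
qed

lemma minimal_vertex_set_odd_transversal:
  assumes S: "S \<subseteq> fst (complete_multipartite r a)" and inj: "inj_on fst S" and odd: "odd (card S)"
  shows "minimal_vertex_set (complete_multipartite r a) S"
proof -
  let ?G = "complete_multipartite r a"
  have "\<not> odd_neighbours ?G T \<subseteq> odd_neighbours ?G S" if T: "T \<noteq> {}" "T \<subset> S" for T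
  proof -
    have TV: "T \<subseteq> fst ?G" and injT: "inj_on fst T"
      using T S inj by (auto intro: inj_on_subset)
    \<comment> \<open>The class of \<open>w\<close> lies in the odd neighbours of \<open>T\<close>; it meets \<open>S\<close>, so it does not lie in
      those of \<open>S\<close>.\<close>
    have "\<exists>w \<in> S. fst w \<in> fst ` T \<longleftrightarrow> even (card T)"
    proof (cases "even (card T)")
      case True
      with T show ?thesis by blast
    next
      case False
      from T(2) obtain w where "w \<in> S" "w \<notin> T" by blast
      moreover from this have "fst w \<notin> fst ` T"
        using T(2) inj by (auto simp: inj_on_def)
      ultimately show ?thesis using False by blast
    qed
    then obtain w where "w \<in> S" "fst w \<in> fst ` T \<longleftrightarrow> even (card T)" by blast
    then have "w \<in> odd_neighbours ?G T" "w \<notin> odd_neighbours ?G S"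
      unfolding odd_neighbours_transversal[OF TV injT] odd_neighbours_transversal[OF S inj]
      using S odd by auto
    then show ?thesis by blast
  qed
  moreover have "S \<noteq> {}" using odd by auto
  ultimately show ?thesis using S by (auto simp: minimal_vertex_set_def)
qed

lemma minimal_vertex_set_large_imp_odd_transversal:
  assumes min: "minimal_vertex_set (complete_multipartite r a) S" and card: "card S \<ge> 3"
  shows "inj_on fst S \<and> odd (card S)"
proof -
  let ?G = "complete_multipartite r a"
  have S: "S \<subseteq> fst ?G" using min by (simp add: minimal_vertex_set_def)
  have pair: "\<not> odd_neighbours ?G {u, v} \<subseteq> odd_neighbours ?G S" if "u \<in> S" "v \<in> S" for u v
  proof -
    have "card {u, v} \<le> 2" by (simp add: card_insert_if)
    then have "{u, v} \<subset> S" using that card by auto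
    moreover have "\<not> odd_neighbours ?G T \<subseteq> odd_neighbours ?G S" if "T \<noteq> {}" "T \<subset> S" for T
      using min that unfolding minimal_vertex_set_def by blast
    ultimately show ?thesis by (metis insert_not_empty)
  qed
  have inj: "inj_on fst S"
  proof (rule inj_onI, rule ccontr)
    fix u v assume uv: "u \<in> S" "v \<in> S" "fst u = fst v" "u \<noteq> v"
    then have "odd_neighbours ?G {u, v} = {}"
      using S by (intro odd_neighbours_same_class) auto
    with pair[OF uv(1,2)] show False by simp
  qed
  moreover have "odd (card S)"
  proof
    assume even: "even (card S)"
    obtain T where "T \<subseteq> S" "card T = 2"
      using card by (auto intro: obtain_subset_with_card_n[of 2 S])
    then obtain u v where uv: "u \<in> S" "v \<in> S" "u \<noteq> v" by (auto simp: card_2_iff)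
    have "inj_on fst {u, v}" by (rule inj_on_subset[OF inj]) (use uv in blast)
    then have "odd_neighbours ?G {u, v} = {w \<in> fst ?G. fst w \<in> fst ` {u, v} \<longleftrightarrow> even (card {u, v})}"
      using uv S by (intro odd_neighbours_transversal) auto
    also have "\<dots> \<subseteq> odd_neighbours ?G S"
      unfolding odd_neighbours_transversal[OF S inj] using uv even by auto
    finally show False using pair[OF uv(1,2)] by blast
  qed
  ultimately show ?thesis by blast
qed

section \<open>Counting\<close>

text \<open>A set that meets each class indexed by \<open>U\<close> exactly once, and no other class, is the graph
  of a unique function that chooses an element of \<open>B i\<close> for each \<open>i \<in> U\<close>.\<close>

lemma card_transversals_over:
  assumes fin: "finite U"
  shows "card {S. S \<subseteq> Sigma U B \<and> inj_on fst S \<and> fst ` S = U} = (\<Prod>i\<in>U. card (B i))"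
proof -
  have "{S. S \<subseteq> Sigma U B \<and> inj_on fst S \<and> fst ` S = U} = (\<lambda>f. (\<lambda>i. (i, f i)) ` U) ` PiE U B"
    (is "?L = ?g ` _")
  proof (intro equalityI subsetI)
    fix S assume "S \<in> ?L"
    then have S: "S \<subseteq> Sigma U B" "inj_on fst S" "fst ` S = U" by auto
    define f where "f = restrict (\<lambda>i. snd (the_inv_into S fst i)) U"
    have inv: "the_inv_into S fst i \<in> S" "fst (the_inv_into S fst i) = i" if "i \<in> U" for i
      using S that by (auto intro: the_inv_into_into f_the_inv_into_f)
    have pair: "(i, f i) = the_inv_into S fst i" if "i \<in> U" for i
      using inv(2)[OF that] that by (simp add: f_def prod_eq_iff)
    have "f \<in> PiE U B"
    proof (rule PiE_I)
      fix i assume "i \<in> U"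
      with inv(1) pair S(1) have "(i, f i) \<in> Sigma U B" by auto
      then show "f i \<in> B i" by simp
    qed (simp add: f_def)
    moreover have "S = ?g f"
    proof -
      have "?g f = the_inv_into S fst ` U" using pair by (intro image_cong) auto
      also have "\<dots> = S" using the_inv_into_onto[OF S(2)] S(3) by simp
      finally show ?thesis by simp
    qed
    ultimately show "S \<in> ?g ` PiE U B" by blast
  next
    fix S assume "S \<in> ?g ` PiE U B"
    then show "S \<in> ?L" by (auto simp: inj_on_def PiE_mem image_image)
  qed
  moreover have "inj_on ?g (PiE U B)"
  proof (rule inj_onI)
    fix f g assume fg: "f \<in> PiE U B" "g \<in> PiE U B" "?g f = ?g g"
    show "f = g"
    proof (rule PiE_ext[OF fg(1,2)])
      fix i assume "i \<in> U"
      then have "(i, f i) \<in> ?g g" unfolding fg(3)[symmetric] by blast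
      then show "f i = g i" by auto
    qed
  qed
  ultimately show ?thesis using fin by (simp add: card_image card_PiE)
qed

lemma card_transversals:
  assumes I: "finite I" and B: "\<And>i. i \<in> I \<Longrightarrow> finite (B i)"
  shows "card {S. S \<subseteq> Sigma I B \<and> inj_on fst S \<and> P (card S)} =
     (\<Sum>U | U \<subseteq> I \<and> P (card U). \<Prod>i\<in>U. card (B i))"
proof -
  let ?F = "\<lambda>U. {S. S \<subseteq> Sigma U B \<and> inj_on fst S \<and> fst ` S = U}"
  have "{S. S \<subseteq> Sigma I B \<and> inj_on fst S \<and> P (card S)} = (\<Union>U \<in> {U. U \<subseteq> I \<and> P (card U)}. ?F U)"
  proof (intro equalityI subsetI)
    fix S assume "S \<in> {S. S \<subseteq> Sigma I B \<and> inj_on fst S \<and> P (card S)}"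
    then have S: "S \<subseteq> Sigma I B" "inj_on fst S" "P (card S)" by auto
    then have "fst ` S \<subseteq> I" "P (card (fst ` S))" "S \<in> ?F (fst ` S)"
      by (auto simp: card_image) force
    then show "S \<in> (\<Union>U \<in> {U. U \<subseteq> I \<and> P (card U)}. ?F U)" by blast
  next
    fix S assume "S \<in> (\<Union>U \<in> {U. U \<subseteq> I \<and> P (card U)}. ?F U)"
    then obtain U where U: "U \<subseteq> I" "P (card U)" "S \<subseteq> Sigma U B" "inj_on fst S" "fst ` S = U" by blast
    have "Sigma U B \<subseteq> Sigma I B" using U(1) by blast
    with U show "S \<in> {S. S \<subseteq> Sigma I B \<and> inj_on fst S \<and> P (card S)}"
      by (auto simp: card_image)
  qed
  moreover have "card (\<Union>U \<in> {U. U \<subseteq> I \<and> P (card U)}. ?F U) =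
      (\<Sum>U | U \<subseteq> I \<and> P (card U). card (?F U))"
  proof (rule card_UN_disjoint)
    show "finite {U. U \<subseteq> I \<and> P (card U)}" using I by simp
    show "\<forall>U \<in> {U. U \<subseteq> I \<and> P (card U)}. finite (?F U)"
    proof
      fix U assume "U \<in> {U. U \<subseteq> I \<and> P (card U)}"
      then have "finite (Sigma U B)" using I B by (auto intro: finite_subset)
      then show "finite (?F U)" by simp
    qed
  qed auto
  moreover have "card (?F U) = (\<Prod>i\<in>U. card (B i))" if "U \<subseteq> I" for U
    using that I by (intro card_transversals_over) (rule finite_subset)
  ultimately show ?thesis by simp
qed

theorem proposition3p5:
  fixes r n :: nat and a :: "nat \<Rightarrow> nat" and vs :: "(nat \<times> nat) list"
  assumes "r \<ge> 3"
    and "\<And>i. i \<in> {1..r} \<Longrightarrow> a i > 0"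
    and "n = (\<Sum>i=1..r. a i)"
    and "labeling (complete_multipartite r a) vs"
  shows "num_minimal_codewords (complete_multipartite r a) vs =
    n + (n choose 2) +
    (\<Sum>U | U \<subseteq> {1..r} \<and> card U mod 2 = 1 \<and> card U \<ge> 3. \<Prod>i\<in>U. a i)"
proof -
  let ?G = "complete_multipartite r a"
  let ?V = "SIGMA i:{1..r}. {..<a i}"
  let ?A = "{S. S \<subseteq> ?V \<and> card S = 1}" and ?B = "{S. S \<subseteq> ?V \<and> card S = 2}"
    and ?C = "{S. S \<subseteq> ?V \<and> inj_on fst S \<and> card S mod 2 = 1 \<and> card S \<ge> 3}"
  have V: "fst ?G = ?V" by (rule fst_complete_multipartite)
  have finV: "finite ?V" by simp
  have cardV: "card ?V = n" using assms(3) by simp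
  have "{S. minimal_vertex_set ?G S} = ?A \<union> ?B \<union> ?C"
  proof (intro equalityI subsetI)
    fix S assume "S \<in> {S. minimal_vertex_set ?G S}"
    then have min: "minimal_vertex_set ?G S" by simp
    then have S: "S \<subseteq> ?V" "S \<noteq> {}" by (auto simp: minimal_vertex_set_def V)
    then have "card S \<noteq> 0" using finite_subset[OF S(1) finV] by simp
    then consider "card S = 1" | "card S = 2" | "card S \<ge> 3" by linarith
    then show "S \<in> ?A \<union> ?B \<union> ?C"
    proof cases
      case 3
      with minimal_vertex_set_large_imp_odd_transversal[OF min] S(1) show ?thesis
        by (simp add: odd_iff_mod_2_eq_one)
    qed (use S(1) in simp_all)
  next
    fix S assume "S \<in> ?A \<union> ?B \<union> ?C"
    then consider "S \<in> ?A" | "S \<in> ?B" | "S \<in> ?C" by blast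
    then show "S \<in> {S. minimal_vertex_set ?G S}"
    proof cases
      case 1
      then obtain v where v: "S = {v}" using card_1_singletonE by blast
      with 1 have "v \<in> fst ?G" unfolding V by blast
      with v show ?thesis using minimal_vertex_set_singleton by simp
    next
      case 2
      then show ?thesis using minimal_vertex_set_pair[OF assms(1,2)] V by simp
    next
      case 3
      then show ?thesis
        using minimal_vertex_set_odd_transversal[of S r a] V by (simp add: odd_iff_mod_2_eq_one)
    qed
  qed
  moreover have fin: "finite ?A" "finite ?B" "finite ?C"
    using finV by (auto intro: finite_subset[of _ "Pow ?V"])
  moreover have "card ((?A \<union> ?B) \<union> ?C) = card ?A + card ?B + card ?C"
  proof -
    have "card ((?A \<union> ?B) \<union> ?C) = card (?A \<union> ?B) + card ?C"
      using fin by (intro card_Un_disjoint finite_UnI) auto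
    also have "card (?A \<union> ?B) = card ?A + card ?B"
      using fin by (intro card_Un_disjoint) auto
    finally show ?thesis .
  qed
  moreover have "card ?A = n" "card ?B = n choose 2"
    using n_subsets[OF finV, of 1] n_subsets[OF finV, of 2] cardV by simp_all
  moreover have "card ?C = (\<Sum>U | U \<subseteq> {1..r} \<and> card U mod 2 = 1 \<and> card U \<ge> 3. \<Prod>i\<in>U. a i)"
    using card_transversals[of "{1..r}" "\<lambda>i. {..<a i}" "\<lambda>k. k mod 2 = 1 \<and> k \<ge> 3"] by simp
  ultimately show ?thesis
    using num_minimal_codewords_eq_card[OF assms(4)] by simp
qed

end
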